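(* We have $$A^{1324}(x,q)=1+I^{1324}(x,q)+I^{132}(x,q)\left(A^{213}(x,q)-1\right).$$ Also, $$I^{1324}(x)=A^{1324}(x)-1-(1-x)\left(C(x)-1\right)^2.$$ Moreover, $I^{1324}_1=1$ and for $n\ge2$, $$I^{1324}_n=A^{1324}_n-C_{n+1}+3C_n-2C_{n-1},$$ where $C_m=\frac1{m+1}\binom{2m}m$ is the $m$-th Catalan number and $C(x)=\sum_{m\ge0}C_mx^m=\frac{1-\sqrt{1-4x}}{2x}$.
   Context: For a permutation $\pi=\pi_1\cdots\pi_n$ of $[n]$, let $i_\pi$ be the smallest index $i$ with $\{\pi_1,\dots,\pi_i\}=\{1,\dots,i\}$; $\pi$ is indecomposable if $i_\pi=n$ (the empty permutation is not indecomposable). A permutation $\pi$ avoids a pattern $\tau\in\mathfrak S_k$ if no subsequence $\pi_{j_1}\cdots\pi_{j_k}$ ($j_1<\cdots<j_k$) is order-isomorphic to $\tau$. A descent of $\pi$ is an index $i$ with $\pi_i>\pi_{i+1}$. For a pattern $\sigma$, $A^\sigma_{n,i}$ (resp. $I^\sigma_{n,i}$) is the number of $\sigma$-avoiding permutations (resp. $\sigma$-avoiding indecomposable permutations) of $[n]$ with $i$ descents; $A^\sigma_n=\sum_iA^\sigma_{n,i}$ ($A^\sigma_0=1$), $I^\sigma_n=\sum_iI^\sigma_{n,i}$; $A^\sigma(x,q)=1+\sum_{n\ge1}\sum_iA^\sigma_{n,i}x^nq^i$, $I^\sigma(x,q)=\sum_{n\ge1}\sum_iI^\sigma_{n,i}x^nq^i$,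 $A^\sigma(x)=A^\sigma(x,1)$, $I^\sigma(x)=I^\sigma(x,1)$. *)

theory Defs
  imports
    Complex_Main
    "HOL-Library.Sublist"
    "HOL-Combinatorics.Multiset_Permutations"
    "HOL-Computational_Algebra.Computational_Algebra"
begin

text \<open>
  A permutation of $[n]$ is written in one-line notation, as a list in
  \<^term>\<open>permutations_of_set {1..n}\<close>; patterns are given in the same way.
\<close>

definition order_isomorphic :: "nat list \<Rightarrow> nat list \<Rightarrow> bool" where
  "order_isomorphic u v \<longleftrightarrow>
     length u = length v \<and>
     (\<forall>a < length u. \<forall>b < length u. u ! a < u ! b \<longleftrightarrow> v ! a < v ! b)"

definition avoids :: "nat list \<Rightarrow> nat list \<Rightarrow> bool" where
  "avoids \<pi> \<tau> \<longleftrightarrow> \<not> (\<exists>u. subseq u \<pi> \<and> order_isomorphic u \<tau>)"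

definition descents :: "nat list \<Rightarrow> nat" where
  "descents \<pi> = card {i. Suc i < length \<pi> \<and> \<pi> ! i > \<pi> ! Suc i}"

text \<open>
  The index ranges over $i \ge 1$, as $i = 0$ would satisfy the condition trivially.
  For the empty list no index qualifies and the value is irrelevant.
\<close>

definition first_component_length :: "nat list \<Rightarrow> nat" where
  "first_component_length \<pi> =
     (LEAST i. 1 \<le> i \<and> i \<le> length \<pi> \<and> set (take i \<pi>) = {1..i})"

definition indecomposable :: "nat list \<Rightarrow> bool" where
  "indecomposable \<pi> \<longleftrightarrow> \<pi> \<noteq> [] \<and> first_component_length \<pi> = length \<pi>"

text \<open>The numbers $A^\sigma_{n,i}$ and $I^\sigma_{n,i}$.\<close>

definition A_coeff :: "nat list \<Rightarrow> nat \<Rightarrow> nat \<Rightarrow> nat" where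
  "A_coeff \<sigma> n i =
     card {\<pi> \<in> permutations_of_set {1..n}. avoids \<pi> \<sigma> \<and> descents \<pi> = i}"

definition I_coeff :: "nat list \<Rightarrow> nat \<Rightarrow> nat \<Rightarrow> nat" where
  "I_coeff \<sigma> n i =
     card {\<pi> \<in> permutations_of_set {1..n}.
             avoids \<pi> \<sigma> \<and> indecomposable \<pi> \<and> descents \<pi> = i}"

text \<open>By the following bound, the sums below may be restricted to $i \le n$.\<close>

lemma descents_le_length: "descents \<pi> \<le> length \<pi>"
proof -
  have "{i. Suc i < length \<pi> \<and> \<pi> ! i > \<pi> ! Suc i} \<subseteq> {..<length \<pi>}"
    by auto
  from card_mono[OF _ this] show ?thesis
    by (simp add: descents_def)
qed

definition A_total :: "nat list \<Rightarrow> nat \<Rightarrow> nat" where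
  "A_total \<sigma> n = (\<Sum>i\<le>n. A_coeff \<sigma> n i)"

definition I_total :: "nat list \<Rightarrow> nat \<Rightarrow> nat" where
  "I_total \<sigma> n = (\<Sum>i\<le>n. I_coeff \<sigma> n i)"

text \<open>
  The series $A^\sigma(x,q)$ and $I^\sigma(x,q)$ are power series in $x$ whose
  coefficients are polynomials in $q$.
\<close>

definition A_gf :: "nat list \<Rightarrow> real poly fps" where
  "A_gf \<sigma> = 1 + Abs_fps (\<lambda>n. if n = 0 then 0
                 else \<Sum>i\<le>n. monom (of_nat (A_coeff \<sigma> n i)) i)"

definition I_gf :: "nat list \<Rightarrow> real poly fps" where
  "I_gf \<sigma> = Abs_fps (\<lambda>n. if n = 0 then 0
                 else \<Sum>i\<le>n. monom (of_nat (I_coeff \<sigma> n i)) i)"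

text \<open>Substitution of a number for $q$.\<close>

definition eval_q :: "real poly fps \<Rightarrow> real \<Rightarrow> real fps" where
  "eval_q F c = Abs_fps (\<lambda>n. poly (fps_nth F n) c)"

definition catalan :: "nat \<Rightarrow> real" where
  "catalan m = 1 / (of_nat m + 1) * of_nat ((2 * m) choose m)"

definition catalan_gf :: "real fps" where
  "catalan_gf = Abs_fps catalan"

end

theory Submission
  imports Defs
begin

text \<open>
  Split a decomposable permutation after its first component, as a direct sum of an
  indecomposable $\sigma$ and a nonempty $\tau$. An occurrence of 1324 in a direct sum
  cannot have its entries 3 and 2 in different summands, so the sum avoids 1324 iff $\sigma$
  avoids 132 and $\tau$ avoids 213. The junction is an ascent, so descents add up, which
  gives the first identity. In the same way a direct sum avoids 132 iff $\sigma$ avoids 132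
  and $\tau$ is increasing, whence $C(x) - 1 = I^{132}(x) / (1 - x)$. The number of
  132-avoiders is found by splitting at the maximum; everything before it must exceed
  everything after it, which is the Catalan recurrence.
\<close>

text \<open>Without this, the simplifier would turn the entry 1 of every pattern into
  \<^term>\<open>Suc 0\<close>.\<close>
declare One_nat_def [simp del]

section \<open>Pattern containment\<close>

lemma order_isomorphic_21:
  "order_isomorphic u [2,1] \<longleftrightarrow> (\<exists>a b. u = [a,b] \<and> b < a)"
  by (auto simp: order_isomorphic_def length_Suc_conv All_less_Suc2 cong: conj_cong)
     (auto simp: less_Suc_eq)

lemma order_isomorphic_132:
  "order_isomorphic u [1,3,2] \<longleftrightarrow> (\<exists>a b c. u = [a,b,c] \<and> a < c \<and> c < b)"
  by (auto simp: order_isomorphic_def length_Suc_conv All_less_Suc2 cong: conj_cong)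
     (auto simp: less_Suc_eq)

lemma order_isomorphic_213:
  "order_isomorphic u [2,1,3] \<longleftrightarrow> (\<exists>a b c. u = [a,b,c] \<and> b < a \<and> a < c)"
  by (auto simp: order_isomorphic_def length_Suc_conv All_less_Suc2 cong: conj_cong)
     (auto simp: less_Suc_eq)

lemma order_isomorphic_1324:
  "order_isomorphic u [1,3,2,4] \<longleftrightarrow>
     (\<exists>a b c d. u = [a,b,c,d] \<and> a < c \<and> c < b \<and> b < d)"
  by (auto simp: order_isomorphic_def length_Suc_conv All_less_Suc2 cong: conj_cong)
     (auto simp: less_Suc_eq)

lemma avoids_21: "avoids \<pi> [2,1] \<longleftrightarrow> (\<forall>a b. subseq [a,b] \<pi> \<longrightarrow> \<not> b < a)"
  by (auto simp: avoids_def order_isomorphic_21)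

lemma avoids_132:
  "avoids \<pi> [1,3,2] \<longleftrightarrow> (\<forall>a b c. subseq [a,b,c] \<pi> \<longrightarrow> \<not> (a < c \<and> c < b))"
  unfolding avoids_def order_isomorphic_132 by blast

lemma avoids_213:
  "avoids \<pi> [2,1,3] \<longleftrightarrow> (\<forall>a b c. subseq [a,b,c] \<pi> \<longrightarrow> \<not> (b < a \<and> a < c))"
  unfolding avoids_def order_isomorphic_213 by blast

lemma avoids_1324:
  "avoids \<pi> [1,3,2,4] \<longleftrightarrow>
     (\<forall>a b c d. subseq [a,b,c,d] \<pi> \<longrightarrow> \<not> (a < c \<and> c < b \<and> b < d))"
  unfolding avoids_def order_isomorphic_1324 by blast

lemma subseq_set_subset: "subseq xs ys \<Longrightarrow> set xs \<subseteq> set ys"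
  by (induction rule: list_emb.induct) auto

lemma avoids_subseq: "subseq xs ys \<Longrightarrow> avoids ys p \<Longrightarrow> avoids xs p"
  unfolding avoids_def using subseq_order.trans by blast

lemma order_isomorphic_map_add:
  "order_isomorphic (map ((+) k) u) p \<longleftrightarrow> order_isomorphic u p"
  by (auto simp: order_isomorphic_def)

text \<open>Choosing the same positions before and after the shift matches the subsequences of the
  two lists, and order isomorphism ignores a common shift.\<close>

lemma avoids_map_add: "avoids (map ((+) k) \<pi>) p \<longleftrightarrow> avoids \<pi> p"
proof -
  have "subseq u (map ((+) k) \<pi>) \<longleftrightarrow> (\<exists>v. subseq v \<pi> \<and> u = map ((+) k) v)" for u
  proof
    assume "subseq u (map ((+) k) \<pi>)"
    then obtain N where "u = nths (map ((+) k) \<pi>) N"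
      by (auto simp: subseq_conv_nths)
    then show "\<exists>v. subseq v \<pi> \<and> u = map ((+) k) v"
      by (auto simp: nths_map subseq_conv_nths)
  qed (auto intro: subseq_map)
  then show ?thesis
    unfolding avoids_def by (metis order_isomorphic_map_add)
qed

text \<open>Recording the cut as a number \<open>i\<close> turns the question of which entries of an
  occurrence lie in which part into a finite case distinction.\<close>

lemma subseq_append_split:
  assumes "subseq xs (S @ T)"
  shows "\<exists>i\<le>length xs. subseq (take i xs) S \<and> subseq (drop i xs) T"
proof -
  from assms obtain us vs where "xs = us @ vs" "subseq us S" "subseq vs T"
    by (auto simp: subseq_append_iff)
  then show ?thesis
    by (intro exI[of _ "length us"]) simp
qed

section \<open>Avoidance in a list whose first part lies below its second part\<close>

lemma avoids_21_iff_sorted: "avoids \<pi> [2,1] \<longleftrightarrow> sorted \<pi>"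
proof (induction \<pi>)
  case Nil
  then show ?case by (simp add: avoids_21)
next
  case (Cons x xs)
  have "subseq [a,b] (x # xs) \<longleftrightarrow> (a = x \<and> b \<in> set xs) \<or> subseq [a,b] xs" for a b
    using subseq_set_subset[of "[a,b]" xs] subseq_Cons2_neq[of a "[b]" x xs]
    by (cases "a = x") (auto simp: subseq_singleton_left)
  then have "avoids (x # xs) [2,1] \<longleftrightarrow> (\<forall>y\<in>set xs. x \<le> y) \<and> avoids xs [2,1]"
    unfolding avoids_21 by (metis not_less)
  with Cons.IH show ?case by simp
qed

text \<open>The entries 3 and 2 cannot be separated by the cut. If both lie in \<open>T\<close>,
  they form a 21 there, and conversely any entry of \<open>S\<close> completes a 21 in
  \<open>T\<close> to a 132; this is where \<open>S\<close> must be nonempty.\<close>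

lemma avoids_132_append:
  assumes less: "\<And>s t. s \<in> set S \<Longrightarrow> t \<in> set T \<Longrightarrow> s < t" and "S \<noteq> []"
  shows "avoids (S @ T) [1,3,2] \<longleftrightarrow> avoids S [1,3,2] \<and> avoids T [2,1]"
proof (intro iffI conjI)
  assume av: "avoids (S @ T) [1,3,2]"
  show "avoids S [1,3,2]"
    using av by (rule avoids_subseq[rotated]) (rule subseq_rev_drop_many, simp)
  from \<open>S \<noteq> []\<close> obtain s where s: "s \<in> set S"
    by (cases S) auto
  show "avoids T [2,1]"
    unfolding avoids_21
  proof (intro allI impI notI)
    fix a b assume ab: "subseq [a,b] T" "b < a"
    have "subseq ([s] @ [a,b]) (S @ T)"
      using s ab by (intro list_emb_append_mono) (simp_all add: subseq_singleton_left)
    moreover have "s < b"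
      using less[OF s] subseq_set_subset[OF ab(1)] by auto
    ultimately show False
      using av ab by (auto simp: avoids_132)
  qed
next
  assume av: "avoids S [1,3,2] \<and> avoids T [2,1]"
  show "avoids (S @ T) [1,3,2]"
    unfolding avoids_132
  proof (intro allI impI notI)
    fix a b c assume abc: "subseq [a,b,c] (S @ T)" and lt: "a < c \<and> c < b"
    obtain i where i: "i \<le> length [a,b,c]" "subseq (take i [a,b,c]) S" "subseq (drop i [a,b,c]) T"
      using subseq_append_split[OF abc] by blast
    consider "i = 0" | "i = Suc 0" | "i = 2" | "i = 3"
      using i(1) by fastforce
    then show False
    proof cases
      case 1
      then have "subseq [b,c] T" using i subseq_Cons'[of a "[b,c]" T] by simp
      then show ?thesis using av lt by (auto simp: avoids_21)
    next
      case 2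
      then show ?thesis using i av lt by (auto simp: avoids_21)
    next
      \<comment> \<open>Here 3 falls into \<open>S\<close> and the smaller entry 2 into
        \<open>T\<close>, against the order of the two parts.\<close>
      case 3
      then have "b \<in> set S" "c \<in> set T"
        using i by (auto dest!: subseq_set_subset)
      then show ?thesis using less[of b c] lt by simp
    next
      case 4
      then show ?thesis using i av lt by (auto simp: avoids_132)
    qed
  qed
qed

lemma avoids_1324_append:
  assumes less: "\<And>s t. s \<in> set S \<Longrightarrow> t \<in> set T \<Longrightarrow> s < t"
    and "S \<noteq> []" "T \<noteq> []"
  shows "avoids (S @ T) [1,3,2,4] \<longleftrightarrow> avoids S [1,3,2] \<and> avoids T [2,1,3]"
proof (intro iffI conjI)
  assume av: "avoids (S @ T) [1,3,2,4]"
  \<comment> \<open>An arbitrary \<open>s\<close> of \<open>S\<close> will play the entry 1 in front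
    of a 213 in \<open>T\<close>, and an arbitrary \<open>t\<close> of \<open>T\<close> the entry 4
    behind a 132 in \<open>S\<close>.\<close>
  from \<open>S \<noteq> []\<close> obtain s where s: "s \<in> set S"
    by (cases S) auto
  from \<open>T \<noteq> []\<close> obtain t where t: "t \<in> set T"
    by (cases T) auto
  show "avoids S [1,3,2]"
    unfolding avoids_132
  proof (intro allI impI notI)
    fix a b c assume abc: "subseq [a,b,c] S" "a < c \<and> c < b"
    have "subseq ([a,b,c] @ [t]) (S @ T)"
      using t abc by (intro list_emb_append_mono) (simp_all add: subseq_singleton_left)
    moreover have "b < t"
      using less[OF _ t] subseq_set_subset[OF abc(1)] by auto
    ultimately show False
      using av abc by (auto simp: avoids_1324)
  qed
  show "avoids T [2,1,3]"
    unfolding avoids_213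
  proof (intro allI impI notI)
    fix a b c assume abc: "subseq [a,b,c] T" "b < a \<and> a < c"
    have "subseq ([s] @ [a,b,c]) (S @ T)"
      using s abc by (intro list_emb_append_mono) (simp_all add: subseq_singleton_left)
    moreover have "s < b"
      using less[OF s] subseq_set_subset[OF abc(1)] by auto
    ultimately show False
      using av abc by (auto simp: avoids_1324)
  qed
next
  assume av: "avoids S [1,3,2] \<and> avoids T [2,1,3]"
  show "avoids (S @ T) [1,3,2,4]"
    unfolding avoids_1324
  proof (intro allI impI notI)
    fix a b c d assume sub: "subseq [a,b,c,d] (S @ T)" and lt: "a < c \<and> c < b \<and> b < d"
    obtain i where i: "i \<le> length [a,b,c,d]" "subseq (take i [a,b,c,d]) S"
      "subseq (drop i [a,b,c,d]) T"
      using subseq_append_split[OF sub] by blast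
    \<comment> \<open>According to the side of the cut on which the entries 3 and 2 lie: both in
      \<open>T\<close> leaves a 213 there, both in \<open>S\<close> leaves a 132 there, and a
      separation is impossible.\<close>
    consider "i \<le> 1" | "i = 2" | "i \<ge> 3"
      by linarith
    then show False
    proof cases
      case 1
      then have "i = 0 \<or> i = Suc 0" by auto
      then have "subseq [b,c,d] T" using i subseq_Cons'[of a "[b,c,d]" T] by auto
      then show ?thesis using av lt by (auto simp: avoids_213)
    next
      case 2
      then have "b \<in> set S" "c \<in> set T"
        using i by (auto dest!: subseq_set_subset)
      then show ?thesis using less[of b c] lt by simp
    next
      case 3
      then have "[a,b,c] = take 3 (take i [a,b,c,d])" by simp
      then have "subseq [a,b,c] S"
        using i(2) subseq_order.trans[OF prefix_imp_subseq[OF take_is_prefix]] by metis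
      then show ?thesis using av lt by (auto simp: avoids_132)
    qed
  qed
qed

section \<open>Descents\<close>

text \<open>The first position contributes according to its two entries, and all later descents are
  those of the tail moved by \<open>Suc\<close>. This makes \<open>descents\<close> accessible to
  list induction.\<close>

lemma descents_simps [simp]:
  "descents [] = 0" "descents [x] = 0"
  "descents (x # y # xs) = of_bool (y < x) + descents (y # xs)"
proof -
  let ?D = "\<lambda>zs. {i. Suc i < length zs \<and> zs ! i > zs ! Suc i}"
  have "i \<in> ?D (x # y # xs) \<longleftrightarrow> i \<in> (if y < x then {0} else {}) \<union> Suc ` ?D (y # xs)" for i
    by (cases i) auto
  then have "?D (x # y # xs) = (if y < x then {0} else {}) \<union> Suc ` ?D (y # xs)"
    by blast
  moreover have "finite (?D (y # xs))"
    by (rule finite_subset[of _ "{..<length (y # xs)}"]) auto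
  ultimately show "descents (x # y # xs) = of_bool (y < x) + descents (y # xs)"
    unfolding descents_def by (auto simp: card_image card_insert_if)
qed (simp_all add: descents_def)

lemma descents_append:
  assumes "\<And>s t. s \<in> set S \<Longrightarrow> t \<in> set T \<Longrightarrow> s < t"
  shows "descents (S @ T) = descents S + descents T"
  using assms
proof (induction S rule: induct_list012)
  \<comment> \<open>Only for a singleton does the recursion reach the junction, which is an
    ascent.\<close>
  case (2 x)
  then show ?case by (cases T) (auto simp: not_less intro: less_imp_le)
qed auto

lemma descents_map_add: "descents (map ((+) k) \<pi>) = descents \<pi>"
  by (induction \<pi> rule: induct_list012) auto

section \<open>Direct sums\<close>

abbreviation perms :: "nat \<Rightarrow> nat list set" where
  "perms n \<equiv> permutations_of_set {1..n}"

definition direct_sum :: "nat list \<Rightarrow> nat list \<Rightarrow> nat list" where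
  "direct_sum \<sigma> \<tau> = \<sigma> @ map ((+) (length \<sigma>)) \<tau>"

lemma permsD:
  assumes "\<pi> \<in> perms n"
  shows "set \<pi> = {1..n}" "distinct \<pi>" "length \<pi> = n"
  using permutations_of_setD[OF assms] length_finite_permutations_of_set[OF assms] by auto

lemma image_add_interval: "(+) k ` {1..m} = {Suc k..k + m}"
  by (simp add: image_add_atLeastAtMost)

lemma unshift:
  assumes "set xs = {Suc k..k + m}" "distinct xs"
  obtains \<tau> where "\<tau> \<in> perms m" "xs = map ((+) k) \<tau>"
proof
  let ?\<tau> = "map (\<lambda>x. x - k) xs"
  \<comment> \<open>All entries exceed \<open>k\<close>, so the truncated subtraction is undone by
    adding \<open>k\<close>.\<close>
  show eq: "xs = map ((+) k) ?\<tau>"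
    using assms(1) by (auto simp: map_idI o_def intro!: map_idI[symmetric])
  have "(+) k ` set ?\<tau> = (+) k ` {1..m}"
    unfolding image_add_interval using arg_cong[OF eq, of set] assms(1) by (metis set_map)
  then have "set ?\<tau> = {1..m}"
    by (simp only: inj_image_eq_iff[OF inj_on_add])
  moreover have "distinct ?\<tau>"
    using assms(2) eq by (metis distinct_map)
  ultimately show "?\<tau> \<in> perms m" by blast
qed

lemma direct_sum_less:
  assumes "\<sigma> \<in> perms k" "\<tau> \<in> perms m" "s \<in> set \<sigma>" "t \<in> set (map ((+) (length \<sigma>)) \<tau>)"
  shows "s < t"
  using assms by (auto simp: permsD)

lemma direct_sum_perms:
  assumes "\<sigma> \<in> perms k" "\<tau> \<in> perms m"
  shows "direct_sum \<sigma> \<tau> \<in> perms (k + m)"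
proof
  show "set (direct_sum \<sigma> \<tau>) = {1..k + m}"
    using assms by (auto simp: direct_sum_def permsD image_add_interval simp del: image_add_atLeastAtMost)
  show "distinct (direct_sum \<sigma> \<tau>)"
    using assms by (auto simp: direct_sum_def permsD distinct_map)
qed

lemma descents_direct_sum:
  assumes "\<sigma> \<in> perms k" "\<tau> \<in> perms m"
  shows "descents (direct_sum \<sigma> \<tau>) = descents \<sigma> + descents \<tau>"
  unfolding direct_sum_def
  by (subst descents_append) (use direct_sum_less[OF assms] in \<open>auto simp: descents_map_add\<close>)

section \<open>First components and the decomposition they induce\<close>

lemma first_component:
  assumes "\<pi> \<in> perms n" "n \<ge> 1"
  defines "k \<equiv> first_component_length \<pi>"
  shows "1 \<le> k" "k \<le> n" "set (take k \<pi>) = {1..k}"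
proof -
  have "1 \<le> k \<and> k \<le> length \<pi> \<and> set (take k \<pi>) = {1..k}"
    unfolding k_def first_component_length_def
    \<comment> \<open>The full length qualifies, so the minimum is taken over a nonempty
      set.\<close>
    by (rule LeastI[of _ n]) (use assms in \<open>simp add: permsD\<close>)
  then show "1 \<le> k" "k \<le> n" "set (take k \<pi>) = {1..k}"
    using assms by (auto simp: permsD)
qed

text \<open>The minimum for \<sigma> is at most \<open>k\<close>, and up to length \<open>k\<close>
  both lists have the same prefixes.\<close>

lemma first_component_length_append:
  assumes "\<sigma> \<in> perms k" "k \<ge> 1"
  shows "first_component_length (\<sigma> @ T) = first_component_length \<sigma>"
proof -
  have fc: "1 \<le> first_component_length \<sigma>" "first_component_length \<sigma> \<le> k"
    "set (take (first_component_length \<sigma>) \<sigma>) = {1..first_component_length \<sigma>}"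
    using first_component[OF assms] by auto
  have len: "length \<sigma> = k" using assms by (simp add: permsD)
  show ?thesis
  proof (unfold first_component_length_def[of "\<sigma> @ T"], rule Least_equality)
    show "1 \<le> first_component_length \<sigma> \<and> first_component_length \<sigma> \<le> length (\<sigma> @ T) \<and>
      set (take (first_component_length \<sigma>) (\<sigma> @ T)) = {1..first_component_length \<sigma>}"
      using fc len by simp
  next
    fix i assume i: "1 \<le> i \<and> i \<le> length (\<sigma> @ T) \<and> set (take i (\<sigma> @ T)) = {1..i}"
    show "first_component_length \<sigma> \<le> i"
    proof (cases "i \<le> k")
      case True
      then show ?thesis
        using i len unfolding first_component_length_def by (intro Least_le) auto
    qed (use fc in auto)
  qed
qed

lemma indecomposable_iff:
  assumes "\<pi> \<in> perms n"
  shows "indecomposable \<pi> \<longleftrightarrow> n \<ge> 1 \<and> first_component_length \<pi> = n"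
  using permsD(3)[OF assms] by (auto simp: indecomposable_def Suc_le_eq One_nat_def)

text \<open>The inverse cuts after the first component. Requiring \<sigma> to be indecomposable
  makes the cut unique; \<tau> is an arbitrary nonempty permutation since
  \<open>k < n\<close>.\<close>

lemma direct_sum_bij_betw:
  "bij_betw (\<lambda>(k, \<sigma>, \<tau>). direct_sum \<sigma> \<tau>)
     (SIGMA k:{1..<n}. {\<sigma> \<in> perms k. indecomposable \<sigma>} \<times> perms (n - k))
     {\<pi> \<in> perms n. n \<ge> 1 \<and> \<not> indecomposable \<pi>}"
  (is "bij_betw ?f ?X ?Y")
  unfolding bij_betw_def
proof
  \<comment> \<open>The length of \<sigma> can be read off from the sum, which yields injectivity
    and shows that the sum is decomposable.\<close>
  have fcl: "first_component_length (direct_sum \<sigma> \<tau>) = k"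
    if "\<sigma> \<in> perms k" "indecomposable \<sigma>" for k \<sigma> \<tau>
    using that first_component_length_append indecomposable_iff by (metis direct_sum_def)
  show "inj_on ?f ?X"
  proof (rule inj_onI)
    fix x y assume xy: "x \<in> ?X" "y \<in> ?X" "?f x = ?f y"
    obtain k \<sigma> \<tau> k' \<sigma>' \<tau>' where x: "x = (k, \<sigma>, \<tau>)" and y: "y = (k', \<sigma>', \<tau>')"
      by (metis prod_cases3)
    have \<sigma>: "\<sigma> \<in> perms k" "indecomposable \<sigma>" "\<sigma>' \<in> perms k'" "indecomposable \<sigma>'"
      and eq: "direct_sum \<sigma> \<tau> = direct_sum \<sigma>' \<tau>'"
      using xy by (simp_all add: x y)
    have "k = k'" using fcl \<sigma> eq by metis
    then show "x = y"
      using eq permsD(3)[OF \<sigma>(1)] permsD(3)[OF \<sigma>(3)]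
      by (auto simp: x y direct_sum_def inj_map_eq_map)
  qed
  show "?f ` ?X = ?Y"
  proof (intro equalityI subsetI)
    fix \<pi> assume "\<pi> \<in> ?f ` ?X"
    then obtain k \<sigma> \<tau> where *: "k \<in> {1..<n}" "\<sigma> \<in> perms k" "indecomposable \<sigma>"
      "\<tau> \<in> perms (n - k)" "\<pi> = direct_sum \<sigma> \<tau>" by auto
    then have "\<pi> \<in> perms n"
      using direct_sum_perms[of \<sigma> k \<tau> "n - k"] by simp
    then show "\<pi> \<in> ?Y"
      using * fcl[of \<sigma> k \<tau>] by (auto simp: indecomposable_iff)
  next
    fix \<pi> assume "\<pi> \<in> ?Y"
    then have \<pi>: "\<pi> \<in> perms n" "n \<ge> 1" "\<not> indecomposable \<pi>" by auto
    define k where "k = first_component_length \<pi>"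
    have k: "1 \<le> k" "k \<le> n" "set (take k \<pi>) = {1..k}"
      using first_component[OF \<pi>(1,2)] by (simp_all add: k_def)
    moreover have "k \<noteq> n" using \<pi> by (auto simp: indecomposable_iff k_def)
    ultimately have kn: "k \<in> {1..<n}" by auto
    have dist: "distinct (take k \<pi> @ drop k \<pi>)" using \<pi> permsD by simp
    have \<sigma>: "take k \<pi> \<in> perms k" using k dist by auto
    have "first_component_length (take k \<pi>) = k"
      using first_component_length_append[OF \<sigma> k(1), of "drop k \<pi>"] by (simp add: k_def)
    then have ind: "indecomposable (take k \<pi>)"
      using \<sigma> k(1) by (simp add: indecomposable_iff)
    have "set (take k \<pi>) \<union> set (drop k \<pi>) = {1..n}"
      using permsD(1)[OF \<pi>(1)] by (metis append_take_drop_id set_append)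
    moreover have "set (take k \<pi>) \<inter> set (drop k \<pi>) = {}"
      using dist unfolding distinct_append by blast
    \<comment> \<open>The prefix uses up exactly \<open>{1..k}\<close>, so the rest is an interval
      and becomes a permutation after shifting down.\<close>
    ultimately have "set (drop k \<pi>) = {1..n} - {1..k}" using k by blast
    also have "\<dots> = {Suc k..k + (n - k)}" using k by auto
    finally obtain \<tau> where \<tau>: "\<tau> \<in> perms (n - k)" "drop k \<pi> = map ((+) k) \<tau>"
      using dist by (auto elim: unshift)
    have "\<pi> = direct_sum (take k \<pi>) \<tau>"
      using \<tau>(2) permsD(3)[OF \<sigma>] by (simp add: direct_sum_def flip: \<tau>(2))
    then show "\<pi> \<in> ?f ` ?X"
      using kn \<sigma> ind \<tau> by force
  qed
qed

section \<open>Generating functions\<close>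

definition Av :: "nat list \<Rightarrow> nat \<Rightarrow> nat list set" where
  "Av p n = {\<pi> \<in> perms n. avoids \<pi> p}"

definition indec_Av :: "nat list \<Rightarrow> nat \<Rightarrow> nat list set" where
  "indec_Av p n = {\<pi> \<in> Av p n. indecomposable \<pi>}"

lemma finite_Av [simp, intro]: "finite (Av p n)"
  by (simp add: Av_def)

lemma finite_indec_Av [simp, intro]: "finite (indec_Av p n)"
  by (simp add: indec_Av_def)

text \<open>The empty list contains only the empty pattern.\<close>

lemma Av_0: "p \<noteq> [] \<Longrightarrow> Av p 0 = {[]}"
  by (auto simp: Av_def avoids_def order_isomorphic_def)

lemma indec_Av_0: "indec_Av p 0 = {}"
  by (auto simp: indec_Av_def Av_def indecomposable_def)

text \<open>Grouping by the number of descents collects equal monomials. Sums of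
  \<open>monom 1 (descents \<pi>)\<close> over a set can be transported along bijections, unlike the
  separate coefficients.\<close>

lemma sum_monom_descents:
  assumes "S \<subseteq> perms n"
  shows "(\<Sum>i\<le>n. monom (of_nat (card {\<pi> \<in> S. descents \<pi> = i})) i) =
           (\<Sum>\<pi>\<in>S. monom (1::real) (descents \<pi>))"
proof -
  have fin: "finite S"
    using assms by (rule finite_subset) simp
  have le: "descents ` S \<subseteq> {..n}"
    using assms descents_le_length permsD(3) by fastforce
  have "(\<Sum>\<pi>\<in>S. monom (1::real) (descents \<pi>)) =
      (\<Sum>i\<le>n. \<Sum>\<pi>\<in>{\<pi> \<in> S. descents \<pi> = i}. monom 1 (descents \<pi>))"
    using fin le by (intro sum.group[symmetric]) auto
  also have "\<dots> = (\<Sum>i\<le>n. monom (of_nat (card {\<pi> \<in> S. descents \<pi> = i})) i)"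
    by (intro sum.cong) (auto simp: of_nat_monom mult_monom)
  finally show ?thesis ..
qed

lemma sum_card_descents:
  assumes "S \<subseteq> perms n"
  shows "(\<Sum>i\<le>n. card {\<pi> \<in> S. descents \<pi> = i}) = card S"
proof -
  have "real (\<Sum>i\<le>n. card {\<pi> \<in> S. descents \<pi> = i}) = real (card S)"
    \<comment> \<open>Setting q = 1 turns every monomial into 1.\<close>
    using arg_cong[OF sum_monom_descents[OF assms], of "\<lambda>p. poly p 1"]
    by (simp add: poly_sum poly_monom)
  then show ?thesis by (simp only: of_nat_eq_iff)
qed

lemma A_coeff_eq: "A_coeff p n i = card {\<pi> \<in> Av p n. descents \<pi> = i}"
  by (auto simp: A_coeff_def Av_def intro!: arg_cong[where f = card])

lemma I_coeff_eq: "I_coeff p n i = card {\<pi> \<in> indec_Av p n. descents \<pi> = i}"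
  by (auto simp: I_coeff_def Av_def indec_Av_def intro!: arg_cong[where f = card])

lemma A_total_eq: "A_total p n = card (Av p n)"
  unfolding A_total_def A_coeff_eq by (rule sum_card_descents) (auto simp: Av_def)

lemma I_total_eq: "I_total p n = card (indec_Av p n)"
  unfolding I_total_def I_coeff_eq
  by (rule sum_card_descents) (auto simp: Av_def indec_Av_def)

lemma A_gf_nth:
  assumes "p \<noteq> []"
  shows "fps_nth (A_gf p) n = (\<Sum>\<pi>\<in>Av p n. monom 1 (descents \<pi>))"
proof (cases "n = 0")
  case True
  then show ?thesis using assms by (simp add: A_gf_def Av_0)
next
  case False
  have "Av p n \<subseteq> perms n" by (auto simp: Av_def)
  with False show ?thesis by (simp add: A_gf_def A_coeff_eq sum_monom_descents)
qed

lemma I_gf_nth: "fps_nth (I_gf p) n = (\<Sum>\<pi>\<in>indec_Av p n. monom 1 (descents \<pi>))"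
proof (cases "n = 0")
  case True
  then show ?thesis by (simp add: I_gf_def indec_Av_0)
next
  case False
  have "indec_Av p n \<subseteq> perms n" by (auto simp: indec_Av_def Av_def)
  with False show ?thesis by (simp add: I_gf_def I_coeff_eq sum_monom_descents)
qed

section \<open>The generating function identity for direct sums\<close>

lemma decomposable_Av_bij_betw:
  assumes av: "\<And>\<sigma> \<tau> k m. \<sigma> \<in> perms k \<Longrightarrow> \<tau> \<in> perms m \<Longrightarrow> k \<ge> 1 \<Longrightarrow> m \<ge> 1 \<Longrightarrow>
      avoids (direct_sum \<sigma> \<tau>) p \<longleftrightarrow> avoids \<sigma> p1 \<and> avoids \<tau> p2"
  shows "bij_betw (\<lambda>(k, \<sigma>, \<tau>). direct_sum \<sigma> \<tau>)
     (SIGMA k:{1..<n}. indec_Av p1 k \<times> Av p2 (n - k))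
     {\<pi> \<in> Av p n. n \<ge> 1 \<and> \<not> indecomposable \<pi>}"
    (is "bij_betw ?f ?X ?Y")
proof -
  let ?X' = "SIGMA k:{1..<n}. {\<sigma> \<in> perms k. indecomposable \<sigma>} \<times> perms (n - k)"
  let ?Y' = "{\<pi> \<in> perms n. n \<ge> 1 \<and> \<not> indecomposable \<pi>}"
  have bij: "bij_betw ?f ?X' ?Y'" by (rule direct_sum_bij_betw)
  have iff: "x \<in> ?X \<longleftrightarrow> x \<in> ?X' \<and> avoids (?f x) p" for x
    using av by (cases x) (auto simp: Av_def indec_Av_def)
  have "?Y = {y \<in> ?Y'. avoids y p}" by (auto simp: Av_def)
  also have "\<dots> = ?f ` {x \<in> ?X'. avoids (?f x) p}"
    unfolding bij_betw_imp_surj_on[OF bij, symmetric] by blast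
  also have "{x \<in> ?X'. avoids (?f x) p} = ?X" using iff by blast
  finally have "?Y = ?f ` ?X" .
  moreover have "inj_on ?f ?X"
    using bij iff by (blast intro: inj_on_subset dest: bij_betw_imp_inj_on)
  ultimately show ?thesis by (simp add: bij_betw_def)
qed

text \<open>Stated for general patterns because it is applied twice: to 1324 with summands avoiding
  132 and 213, and to 132 with summands avoiding 132 and 21. Weights multiply because descents add,
  so the decomposable avoiders contribute a Cauchy product.\<close>

lemma A_gf_decomposition:
  assumes ne: "p \<noteq> []" "p2 \<noteq> []"
    and av: "\<And>\<sigma> \<tau> k m. \<sigma> \<in> perms k \<Longrightarrow> \<tau> \<in> perms m \<Longrightarrow> k \<ge> 1 \<Longrightarrow> m \<ge> 1 \<Longrightarrow>
      avoids (direct_sum \<sigma> \<tau>) p \<longleftrightarrow> avoids \<sigma> p1 \<and> avoids \<tau> p2"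
  shows "A_gf p = 1 + I_gf p + I_gf p1 * (A_gf p2 - 1)"
proof (rule fps_ext)
  fix n
  let ?w = "\<lambda>\<pi>. monom (1::real) (descents \<pi>)"
  show "fps_nth (A_gf p) n = fps_nth (1 + I_gf p + I_gf p1 * (A_gf p2 - 1)) n"
  proof (cases "n = 0")
    case True
    then show ?thesis
      using ne by (simp add: A_gf_nth I_gf_nth Av_0 indec_Av_0)
  next
    case False
    let ?D = "{\<pi> \<in> Av p n. n \<ge> 1 \<and> \<not> indecomposable \<pi>}"
    have bij: "bij_betw (\<lambda>(k, \<sigma>, \<tau>). direct_sum \<sigma> \<tau>)
        (SIGMA k:{1..<n}. indec_Av p1 k \<times> Av p2 (n - k)) ?D"
      by (rule decomposable_Av_bij_betw) (use av in blast)
    have w: "?w (direct_sum \<sigma> \<tau>) = ?w \<sigma> * ?w \<tau>"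
      if "\<sigma> \<in> indec_Av p1 k" "\<tau> \<in> Av p2 m" for \<sigma> \<tau> k m
      using that descents_direct_sum[of \<sigma> k \<tau> m] by (simp add: Av_def indec_Av_def mult_monom)
    have "Av p n = indec_Av p n \<union> ?D" "indec_Av p n \<inter> ?D = {}"
      using False by (auto simp: indec_Av_def)
    then have "fps_nth (A_gf p) n = fps_nth (I_gf p) n + sum ?w ?D"
      by (simp add: A_gf_nth[OF ne(1)] I_gf_nth sum.union_disjoint[symmetric])
    also have "sum ?w ?D =
        (\<Sum>(k, \<sigma>, \<tau>)\<in>(SIGMA k:{1..<n}. indec_Av p1 k \<times> Av p2 (n - k)). ?w (direct_sum \<sigma> \<tau>))"
      by (subst sum.reindex_bij_betw[OF bij, symmetric])
         (auto simp: case_prod_unfold)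
    also have "\<dots> = (\<Sum>(k, \<sigma>, \<tau>)\<in>(SIGMA k:{1..<n}. indec_Av p1 k \<times> Av p2 (n - k)). ?w \<sigma> * ?w \<tau>)"
      by (intro sum.cong) (auto intro: w)
    also have "\<dots> = (\<Sum>k\<in>{1..<n}. \<Sum>(\<sigma>, \<tau>)\<in>indec_Av p1 k \<times> Av p2 (n - k). ?w \<sigma> * ?w \<tau>)"
      by (subst sum.Sigma) auto
    also have "\<dots> = (\<Sum>k\<in>{1..<n}. fps_nth (I_gf p1) k * fps_nth (A_gf p2) (n - k))"
      by (intro sum.cong)
         (simp_all add: I_gf_nth A_gf_nth[OF ne(2)] sum_product sum.cartesian_product)
    \<comment> \<open>Since \<open>n - k > 0\<close>, subtracting the constant 1 does not affect
      these coefficients.\<close>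
    also have "\<dots> = (\<Sum>k\<in>{1..<n}. fps_nth (I_gf p1) k * fps_nth (A_gf p2 - 1) (n - k))"
      by (intro sum.cong) auto
    \<comment> \<open>Neither factor has a constant term, so the added terms for
      \<open>k = 0\<close> and \<open>k = n\<close> vanish.\<close>
    also have "\<dots> = (\<Sum>k\<in>{0..n}. fps_nth (I_gf p1) k * fps_nth (A_gf p2 - 1) (n - k))"
    proof (rule sum.mono_neutral_left, safe)
      fix k assume k: "k \<in> {0..n}" "k \<notin> {1..<n}"
      then have "k = 0 \<or> k = n" by auto
      then show "fps_nth (I_gf p1) k * fps_nth (A_gf p2 - 1) (n - k) = 0"
        using ne by (auto simp: I_gf_nth A_gf_nth Av_0 indec_Av_0)
    qed auto
    also have "\<dots> = fps_nth (I_gf p1 * (A_gf p2 - 1)) n"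
      by (simp add: fps_mult_nth)
    finally show ?thesis using False by simp
  qed
qed

lemma A_gf_1324: "A_gf [1,3,2,4] = 1 + I_gf [1,3,2,4] + I_gf [1,3,2] * (A_gf [2,1,3] - 1)"
proof (rule A_gf_decomposition)
  fix \<sigma> \<tau> k m assume *: "\<sigma> \<in> perms k" "\<tau> \<in> perms m" "k \<ge> 1" "m \<ge> 1"
  then have "\<sigma> \<noteq> []" "map ((+) (length \<sigma>)) \<tau> \<noteq> []" using permsD(3) by fastforce+
  then show "avoids (direct_sum \<sigma> \<tau>) [1,3,2,4] \<longleftrightarrow> avoids \<sigma> [1,3,2] \<and> avoids \<tau> [2,1,3]"
    unfolding direct_sum_def
    by (subst avoids_1324_append) (use direct_sum_less[OF *(1,2)] in \<open>auto simp: avoids_map_add\<close>)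
qed auto

text \<open>Serves to express I^{132} at q = 1 through the Catalan series.\<close>

lemma A_gf_132: "A_gf [1,3,2] = 1 + I_gf [1,3,2] + I_gf [1,3,2] * (A_gf [2,1] - 1)"
proof (rule A_gf_decomposition)
  fix \<sigma> \<tau> k m assume *: "\<sigma> \<in> perms k" "\<tau> \<in> perms m" "k \<ge> 1" "m \<ge> 1"
  then have "\<sigma> \<noteq> []" using permsD(3) by fastforce
  then show "avoids (direct_sum \<sigma> \<tau>) [1,3,2] \<longleftrightarrow> avoids \<sigma> [1,3,2] \<and> avoids \<tau> [2,1]"
    unfolding direct_sum_def
    by (subst avoids_132_append) (use direct_sum_less[OF *(1,2)] in \<open>auto simp: avoids_map_add\<close>)
qed auto

text \<open>Evaluation acts on each coefficient by a ring homomorphism, so identities in x and q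
  carry over to real series.\<close>

lemma eval_q_simps:
  "eval_q 1 c = 1" "eval_q (F + G) c = eval_q F c + eval_q G c"
  "eval_q (F - G) c = eval_q F c - eval_q G c"
  "eval_q (F * G) c = eval_q F c * eval_q G c"
  by (auto simp: eval_q_def fps_eq_iff fps_mult_nth poly_sum)

lemma eval_A_gf_nth: "p \<noteq> [] \<Longrightarrow> fps_nth (eval_q (A_gf p) 1) n = real (card (Av p n))"
  by (simp add: eval_q_def A_gf_nth poly_sum poly_monom)

lemma eval_I_gf_nth: "fps_nth (eval_q (I_gf p) 1) n = real (card (indec_Av p n))"
  by (simp add: eval_q_def I_gf_nth poly_sum poly_monom)

section \<open>Catalan numbers\<close>

lemma catalan_0 [simp]: "catalan 0 = 1"
  by (simp add: catalan_def)

lemma catalan_Suc: "(real n + 2) * catalan (Suc n) = (4 * real n + 2) * catalan n"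
proof -
  have "real ((2 * Suc n) choose Suc n) =
      ((2 * real n + 2) * (2 * real n + 1) * fact (2 * n)) / (fact (Suc n) * fact (Suc n))"
    by (subst binomial_fact) (simp_all add: algebra_simps)
  also have "\<dots> = (2 * real n + 2) * (2 * real n + 1) / (real (Suc n) * real (Suc n)) *
      (fact (2 * n) / (fact n * fact n))"
    by simp
  also have "fact (2 * n) / (fact n * fact n) = real ((2 * n) choose n)"
    by (subst binomial_fact) simp_all
  also have "(2 * real n + 2) * (2 * real n + 1) / (real (Suc n) * real (Suc n)) =
      2 * (2 * real n + 1) / real (Suc n)"
    by (simp add: divide_simps) (simp add: algebra_simps)
  finally have "real (Suc n) * real ((2 * Suc n) choose Suc n) =
      2 * (2 * real n + 1) * real ((2 * n) choose n)"
    by (simp add: field_simps del: binomial_Suc_Suc of_nat_Suc)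
  then show ?thesis
    by (simp add: catalan_def field_simps del: binomial_Suc_Suc)
qed

text \<open>Up to the factor -2, both sides obey the recurrence of \<open>catalan_Suc\<close>: the
  next binomial coefficient brings the factor (1/2 - (n+1))/(n+2), and multiplying by -4 gives
  (4n+2)/(n+2).\<close>

lemma gbinomial_half_Suc: "((1/2::real) gchoose Suc n) * (-4) ^ Suc n = -2 * catalan n"
proof (induction n)
  case 0
  then show ?case by simp
next
  case (Suc n)
  have "(real n + 2) * ((1/2::real) gchoose Suc (Suc n)) =
      (1/2 - real (Suc n)) * ((1/2::real) gchoose Suc n)"
    using gbinomial_mult_1[of "1/2::real" "Suc n"] by (simp add: algebra_simps)
  then have "(real n + 2) * (((1/2::real) gchoose Suc (Suc n)) * (-4) ^ Suc (Suc n)) =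
      -4 * (1/2 - real (Suc n)) * (((1/2::real) gchoose Suc n) * (-4) ^ Suc n)"
    by (simp only: power_Suc mult.assoc[symmetric])
  also have "\<dots> = -2 * ((4 * real n + 2) * catalan n)"
    unfolding Suc.IH by (simp add: algebra_simps)
  also have "\<dots> = (real n + 2) * (-2 * catalan (Suc n))"
    by (simp add: catalan_Suc[symmetric])
  finally show ?case by (simp only: mult_cancel_left) auto
qed

text \<open>Both sides are $\sqrt{1 - 4x}$.\<close>
lemma catalan_gf_binomial:
  "fps_binomial (1/2) oo (fps_const (-4) * fps_X) = 1 - 2 * fps_X * catalan_gf"
proof (rule fps_ext)
  fix n
  show "fps_nth (fps_binomial (1/2) oo (fps_const (-4) * fps_X)) n =
      fps_nth (1 - 2 * fps_X * catalan_gf) n"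
  proof (cases n)
    case 0
    then show ?thesis by (simp add: mult.assoc)
  next
    case (Suc m)
    have "fps_nth (2 * fps_X * catalan_gf) n = 2 * catalan m"
      unfolding Suc by (simp add: mult.assoc catalan_gf_def numeral_fps_const)
    then show ?thesis
      unfolding fps_nth_compose_linear using gbinomial_half_Suc[of m] Suc
      by (simp add: mult.commute del: power_Suc)
  qed
qed

text \<open>The square of the binomial series for exponent 1/2 is 1 + y, evaluated at y =
  -4x.\<close>

lemma catalan_gf_square: "(1 - 2 * fps_X * catalan_gf)\<^sup>2 = 1 - 4 * fps_X"
proof -
  have "(fps_binomial (1/2) oo (fps_const (-4) * fps_X))\<^sup>2 =
      (fps_binomial (1/2 :: real) ^ 2 oo (fps_const (-4) * fps_X))"
    by (rule fps_compose_power) simp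
  also have "fps_binomial (1/2 :: real) ^ 2 = 1 + fps_X"
    by (simp add: fps_binomial_power fps_binomial_1)
  also have "(1 + fps_X) oo (fps_const (-4) * fps_X) = 1 - 4 * (fps_X :: real fps)"
    by (simp add: fps_compose_add_distrib numeral_fps_const flip: fps_const_neg)
  finally show ?thesis unfolding catalan_gf_binomial .
qed

lemma catalan_gf_eq: "catalan_gf = 1 + fps_X * catalan_gf\<^sup>2"
proof -
  \<comment> \<open>Expanding the square gives the functional equation multiplied by 4x, a nonzero
    factor that can be cancelled.\<close>
  have "4 * fps_X * (catalan_gf - (1 + fps_X * catalan_gf\<^sup>2)) = 0"
    using catalan_gf_square by (simp add: algebra_simps power2_eq_square)
  then show ?thesis by simp
qed

lemma catalan_gf_closed_form:
  "catalan_gf = (1 - fps_radical root 2 (1 - 4 * fps_X)) / (2 * fps_X)"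
proof -
  have "1 - 2 * fps_X * catalan_gf = fps_radical root 2 (1 - 4 * fps_X)"
    \<comment> \<open>A square root with constant term 1 is unique; the argument \<open>1\<close>
      stands for the exponent \<open>Suc 1\<close>.\<close>
    using radical_unique[of root 1 "1 - 4 * fps_X :: real fps" "1 - 2 * fps_X * catalan_gf"]
      catalan_gf_square
    by (simp add: numeral_2_eq_2 mult.assoc)
  then have "1 - fps_radical root 2 (1 - 4 * fps_X) = 2 * fps_X * catalan_gf"
    by (simp add: algebra_simps)
  then show ?thesis by simp
qed

text \<open>Compares coefficients in C = 1 + x C^2. The factors are ordered as the two blocks around
  the maximum will be.\<close>

lemma catalan_recurrence: "catalan (Suc n) = (\<Sum>k\<le>n. catalan (n - k) * catalan k)"
proof -
  have "catalan (Suc n) = fps_nth (1 + fps_X * catalan_gf\<^sup>2) (Suc n)"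
    using catalan_gf_eq by (metis catalan_gf_def fps_nth_Abs_fps)
  also have "\<dots> = fps_nth (catalan_gf * catalan_gf) n"
    by (simp add: power2_eq_square)
  also have "\<dots> = (\<Sum>k\<le>n. catalan k * catalan (n - k))"
    by (simp add: fps_mult_nth catalan_gf_def atLeast0AtMost)
  finally show ?thesis by (simp add: mult.commute)
qed

section \<open>Counting permutations avoiding a pattern\<close>

lemma Av_21: "Av [2,1] n = {[1..<Suc n]}"
proof -
  have "\<pi> = [1..<Suc n]" if "\<pi> \<in> perms n" "sorted \<pi>" for \<pi>
    using that permsD[OF that(1)] by (intro sorted_distinct_set_unique)
       (simp_all add: atLeastLessThanSuc_atLeastAtMost del: upt_Suc)
  then show ?thesis
    by (auto simp: Av_def avoids_21_iff_sorted simp del: upt_Suc)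
qed

section \<open>Splitting a 132-avoider at its maximum\<close>

lemma initial_segment:
  assumes "A \<union> B = {1..n}" "\<And>a b. a \<in> A \<Longrightarrow> b \<in> B \<Longrightarrow> a < b"
  shows "A = {1..card A}" "B = {Suc (card A)..n}" "card A \<le> n"
proof -
  have "\<exists>m\<le>n. A = {1..m}"
  proof (cases "A = {}")
    case False
    have fin: "finite A" using assms(1) by (metis finite_Un finite_atLeastAtMost)
    have "A = {1..Max A}"
    proof (intro equalityI subsetI)
      fix x assume "x \<in> A"
      then show "x \<in> {1..Max A}" using assms(1) fin by auto
    next
      fix x assume x: "x \<in> {1..Max A}"
      have "Max A \<in> A" using False fin by simp
      \<comment> \<open>Otherwise \<open>x\<close> would lie in \<open>B\<close> and hence above
        \<open>Max A\<close>.\<close>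
      then show "x \<in> A" using x assms by (metis Un_iff atLeastAtMost_iff leD le_trans)
    qed
    moreover have "Max A \<le> n" using assms(1) False fin Max_in by fastforce
    ultimately show ?thesis by blast
  qed auto
  then obtain m where m: "m \<le> n" "A = {1..m}" by blast
  then show "A = {1..card A}" "card A \<le> n" by auto
  have "A \<inter> B = {}" using assms(2) by blast
  then have "B = {1..n} - A" using assms(1) by blast
  then show "B = {Suc (card A)..n}" using m by auto
qed

text \<open>In terms of sums, this is the skew sum of \<sigma> \<oplus> 1 and \<tau>.\<close>

definition join_max :: "nat list \<Rightarrow> nat list \<Rightarrow> nat list" where
  "join_max \<sigma> \<tau> = map ((+) (length \<tau>)) \<sigma> @ Suc (length \<sigma> + length \<tau>) # \<tau>"

text \<open>The maximum could only play 3, but then 1 before it would exceed 2 after it. An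
  occurrence without the maximum lies in one block, because every entry of the left block exceeds
  every entry of the right one.\<close>

lemma avoids_132_join_max:
  assumes "\<sigma> \<in> perms m" "\<tau> \<in> perms k"
  shows "avoids (join_max \<sigma> \<tau>) [1,3,2] \<longleftrightarrow> avoids \<sigma> [1,3,2] \<and> avoids \<tau> [1,3,2]"
proof (intro iffI conjI)
  assume av: "avoids (join_max \<sigma> \<tau>) [1,3,2]"
  have "avoids (map ((+) (length \<tau>)) \<sigma>) [1,3,2]"
    by (rule avoids_subseq[OF _ av]) (auto simp: join_max_def)
  then show "avoids \<sigma> [1,3,2]" by (simp only: avoids_map_add)
  show "avoids \<tau> [1,3,2]"
    by (rule avoids_subseq[OF _ av]) (auto simp: join_max_def intro: subseq_drop_many)
next
  assume av: "avoids \<sigma> [1,3,2] \<and> avoids \<tau> [1,3,2]"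
  let ?L = "map ((+) k) \<sigma>" and ?x = "Suc (m + k)"
  have L: "x \<in> set ?L \<Longrightarrow> k < x \<and> x < ?x" for x using assms by (auto simp: permsD)
  have T: "x \<in> set \<tau> \<Longrightarrow> x \<le> k" for x using assms by (auto simp: permsD)
  have "\<not> (a < c \<and> c < b)" if sub: "subseq [a,b,c] (?L @ ?x # \<tau>)" for a b c
  proof
    assume lt: "a < c \<and> c < b"
    obtain i where i: "i \<le> length [a,b,c]" "subseq (take i [a,b,c]) ?L"
      "subseq (drop i [a,b,c]) (?x # \<tau>)"
      using subseq_append_split[OF sub] by blast
    consider "i = 0" | "i = Suc 0" | "i = 2" | "i = 3"
      using i(1) by fastforce
    then show False
    proof cases
      case 1
      then have sub: "subseq [a,b,c] (?x # \<tau>)" using i by simp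
      have "b = ?x \<or> b \<in> set \<tau>" using subseq_set_subset[OF sub] by simp
      then have "a \<noteq> ?x" using T[of b] lt by auto
      with sub have "subseq [a,b,c] \<tau>" by (rule subseq_Cons2_neq)
      then show ?thesis using av lt unfolding avoids_132 by blast
    next
      case 2
      then have "a \<in> set ?L" and sub: "subseq [b,c] (?x # \<tau>)"
        using i by (auto simp: subseq_singleton_left)
      have "b = ?x \<or> b \<in> set \<tau>" "c = ?x \<or> c \<in> set \<tau>"
        using subseq_set_subset[OF sub] by simp_all
      then show ?thesis using L[OF \<open>a \<in> set ?L\<close>] T[of b] T[of c] lt by auto
    next
      case 3
      then have "a \<in> set ?L" "b \<in> set ?L" "c = ?x \<or> c \<in> set \<tau>"
        using subseq_set_subset[OF i(2)] subseq_set_subset[OF i(3)] by auto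
      then show ?thesis using L[of a] L[of b] T[of c] lt by auto
    next
      case 4
      then have "subseq [a,b,c] ?L" using i by simp
      moreover have "avoids ?L [1,3,2]" using av by (simp only: avoids_map_add)
      ultimately show ?thesis using lt by (auto simp: avoids_132)
    qed
  qed
  then show "avoids (join_max \<sigma> \<tau>) [1,3,2]"
    unfolding avoids_132 join_max_def permsD(3)[OF assms(1)] permsD(3)[OF assms(2)] by blast
qed

lemma join_max_perms:
  assumes "\<sigma> \<in> perms m" "\<tau> \<in> perms k"
  shows "join_max \<sigma> \<tau> \<in> perms (Suc (m + k))"
proof
  show "set (join_max \<sigma> \<tau>) = {1..Suc (m + k)}"
    using assms by (auto simp: join_max_def permsD image_add_interval simp del: image_add_atLeastAtMost)
  show "distinct (join_max \<sigma> \<tau>)"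
    using assms by (auto simp: join_max_def permsD distinct_map)
qed

lemma join_max_bij_betw:
  "bij_betw (\<lambda>(k, \<sigma>, \<tau>). join_max \<sigma> \<tau>)
     (SIGMA k:{..n}. Av [1,3,2] (n - k) \<times> Av [1,3,2] k) (Av [1,3,2] (Suc n))"
  (is "bij_betw ?f ?X ?Y")
  unfolding bij_betw_def
proof
  show "inj_on ?f ?X"
  proof (rule inj_onI)
    fix x y assume xy: "x \<in> ?X" "y \<in> ?X" "?f x = ?f y"
    obtain k \<sigma> \<tau> k' \<sigma>' \<tau>' where x: "x = (k, \<sigma>, \<tau>)" and y: "y = (k', \<sigma>', \<tau>')"
      by (metis prod_cases3)
    have k: "k \<le> n" "k' \<le> n"
      and av: "\<sigma> \<in> Av [1,3,2] (n - k)" "\<tau> \<in> Av [1,3,2] k"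
        "\<sigma>' \<in> Av [1,3,2] (n - k')" "\<tau>' \<in> Av [1,3,2] k'"
      and eq: "join_max \<sigma> \<tau> = join_max \<sigma>' \<tau>'"
      using xy by (simp_all add: x y)
    then have p: "\<sigma> \<in> perms (n - k)" "\<tau> \<in> perms k" "\<sigma>' \<in> perms (n - k')" "\<tau>' \<in> perms k'"
      by (auto simp: Av_def)
    have "map ((+) k) \<sigma> @ Suc n # \<tau> = map ((+) k') \<sigma>' @ Suc n # \<tau>'"
      using eq p k by (simp add: join_max_def permsD)
    \<comment> \<open>The maximum occurs only once, so it marks the same cut in both lists; the
      length of \<tau> then gives \<open>k\<close>.\<close>
    moreover have "Suc n \<notin> set (map ((+) k) \<sigma>)" "Suc n \<notin> set \<tau>"
      using p k by (auto simp: permsD)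
    ultimately have "map ((+) k) \<sigma> = map ((+) k') \<sigma>'" "\<tau> = \<tau>'"
      by (simp_all add: append_Cons_eq_iff)
    then show "x = y"
      using permsD(3)[OF p(2)] permsD(3)[OF p(4)] by (auto simp: x y inj_map_eq_map)
  qed
  show "?f ` ?X = ?Y"
  proof (intro equalityI subsetI)
    fix \<pi> assume "\<pi> \<in> ?f ` ?X"
    then obtain k \<sigma> \<tau> where *: "k \<le> n" "\<sigma> \<in> Av [1,3,2] (n - k)" "\<tau> \<in> Av [1,3,2] k"
      "\<pi> = join_max \<sigma> \<tau>" by auto
    then show "\<pi> \<in> ?Y"
      using join_max_perms[of \<sigma> "n - k" \<tau> k] avoids_132_join_max[of \<sigma> "n - k" \<tau> k]
      by (simp add: Av_def)
  next
    fix \<pi> assume "\<pi> \<in> ?Y"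
    then have \<pi>: "\<pi> \<in> perms (Suc n)" and av: "avoids \<pi> [1,3,2]" by (auto simp: Av_def)
    have "Suc n \<in> set \<pi>" using \<pi> by (simp add: permsD)
    then obtain L R where LR: "\<pi> = L @ Suc n # R" by (meson split_list)
    have dist: "distinct L" "distinct R" "set L \<inter> set R = {}" "Suc n \<notin> set L \<union> set R"
      using permsD(2)[OF \<pi>] LR by auto
    have "insert (Suc n) (set L \<union> set R) = {1..Suc n}"
      using permsD(1)[OF \<pi>] LR by auto
    then have un: "set R \<union> set L = {1..n}"
      using dist(4) insert_ident[of "Suc n" "set L \<union> set R" "{1..n}"]
      by (simp add: atLeastAtMostSuc_conv Un_commute)
    \<comment> \<open>Otherwise \<open>l\<close>, the maximum and \<open>r\<close> form a 132. Hence
      the entries after the maximum are an initial segment of the values.\<close>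
    have less: "r < l" if "r \<in> set R" "l \<in> set L" for r l
    proof -
      have "subseq ([l] @ [Suc n] @ [r]) (L @ [Suc n] @ R)"
        using that by (intro list_emb_append_mono) (simp_all add: subseq_singleton_left)
      then have "\<not> (l < r \<and> r < Suc n)" using av LR by (simp add: avoids_132)
      moreover have "r \<in> {1..n}" using un that by blast
      then have "r < Suc n" by simp
      moreover have "l \<noteq> r" using dist that by auto
      ultimately show ?thesis by simp
    qed
    define k where "k = length R"
    have "card (set R) = k" using dist by (simp add: distinct_card k_def)
    with initial_segment[OF un less] have R: "R \<in> perms k" and "k \<le> n"
      and L: "set L = {Suc k..k + (n - k)}" using dist by auto
    then obtain \<sigma> where \<sigma>: "\<sigma> \<in> perms (n - k)" "L = map ((+) k) \<sigma>"
      using unshift[OF L dist(1)] by blast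
    have eq: "\<pi> = join_max \<sigma> R"
      using LR \<sigma> R \<open>k \<le> n\<close> by (simp add: join_max_def permsD)
    then have "\<sigma> \<in> Av [1,3,2] (n - k)" "R \<in> Av [1,3,2] k"
      using av avoids_132_join_max[OF \<sigma>(1) R] \<sigma> R by (simp_all add: Av_def)
    then show "\<pi> \<in> ?f ` ?X"
      using eq \<open>k \<le> n\<close> by force
  qed
qed

lemma card_Av_132: "real (card (Av [1,3,2] n)) = catalan n"
proof (induction n rule: less_induct)
  case (less n)
  show ?case
  proof (cases n)
    case 0
    then show ?thesis by (simp add: Av_0)
  next
    case (Suc m)
    have "card (Av [1,3,2] n) = (\<Sum>k\<le>m. card (Av [1,3,2] (m - k)) * card (Av [1,3,2] k))"
      unfolding Suc bij_betw_same_card[OF join_max_bij_betw, symmetric]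
      by (subst card_SigmaI) (auto simp: card_cartesian_product)
    then show ?thesis
      using less.IH Suc by (simp add: catalan_recurrence)
  qed
qed

section \<open>Reverse complement, exchanging 213 and 132\<close>

definition rev_compl :: "nat \<Rightarrow> nat list \<Rightarrow> nat list" where
  "rev_compl n \<pi> = rev (map ((-) (Suc n)) \<pi>)"

lemma rev_compl_perms:
  assumes "\<pi> \<in> perms n"
  shows "rev_compl n \<pi> \<in> perms n"
proof
  have "(-) (Suc n) ` {1..n} = {1..n}"
    by (intro endo_inj_surj) (auto simp: inj_on_def)
  then show "set (rev_compl n \<pi>) = {1..n}"
    using assms by (simp add: rev_compl_def permsD)
  show "distinct (rev_compl n \<pi>)"
    using assms by (auto simp: rev_compl_def permsD distinct_map inj_on_def)
qed

lemma rev_compl_rev_compl: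
  assumes "\<pi> \<in> perms n"
  shows "rev_compl n (rev_compl n \<pi>) = \<pi>"
  using permsD(1)[OF assms] by (auto simp: rev_compl_def rev_map o_def intro!: map_idI)

lemma subseq_rev: "subseq xs ys \<Longrightarrow> subseq (rev xs) (rev ys)"
  by (induction rule: list_emb.induct) (auto intro: subseq_rev_drop_many)

lemma subseq_rev_compl:
  "subseq u \<pi> \<Longrightarrow> subseq (rev_compl n u) (rev_compl n \<pi>)"
  by (simp only: rev_compl_def subseq_map subseq_rev)

text \<open>Reverse complement is an involution on permutations and takes occurrences of one pattern
  to occurrences of the other, so each inclusion follows by pulling a forbidden occurrence
  back.\<close>

lemma rev_compl_bij_betw: "bij_betw (rev_compl n) (Av [2,1,3] n) (Av [1,3,2] n)"
proof (rule bij_betw_byWitness[where f' = "rev_compl n"])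
  have le: "x \<le> n" if "subseq u \<pi>" "\<pi> \<in> perms n" "x \<in> set u" for u \<pi> x
    using that subseq_set_subset[OF that(1)] permsD(1)[OF that(2)] by auto
  show "rev_compl n ` Av [2,1,3] n \<subseteq> Av [1,3,2] n"
  proof
    fix \<rho> assume "\<rho> \<in> rev_compl n ` Av [2,1,3] n"
    then obtain \<pi> where \<pi>: "\<pi> \<in> perms n" "avoids \<pi> [2,1,3]" "\<rho> = rev_compl n \<pi>"
      by (auto simp: Av_def)
    have \<rho>: "\<rho> \<in> perms n" using \<pi> by (simp add: rev_compl_perms)
    have "avoids \<rho> [1,3,2]"
      unfolding avoids_132
    proof (intro allI impI notI)
      fix a b c assume abc: "subseq [a,b,c] \<rho>" "a < c \<and> c < b"
      have "subseq [Suc n - c, Suc n - b, Suc n - a] \<pi>"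
        using subseq_rev_compl[OF abc(1), of n] \<pi>
        by (simp add: rev_compl_rev_compl) (simp add: rev_compl_def)
      \<comment> \<open>The bound on the largest entry keeps truncated subtraction strictly
        decreasing on all three entries.\<close>
      moreover have "b \<le> n" using le[OF abc(1) \<rho>] by simp
      ultimately show False using \<pi>(2) abc(2) unfolding avoids_213
        by (metis Suc_leI diff_less_mono2 le_imp_less_Suc less_trans not_le)
    qed
    with \<rho> show "\<rho> \<in> Av [1,3,2] n" by (simp add: Av_def)
  qed
  show "rev_compl n ` Av [1,3,2] n \<subseteq> Av [2,1,3] n"
  proof
    fix \<rho> assume "\<rho> \<in> rev_compl n ` Av [1,3,2] n"
    then obtain \<pi> where \<pi>: "\<pi> \<in> perms n" "avoids \<pi> [1,3,2]" "\<rho> = rev_compl n \<pi>"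
      by (auto simp: Av_def)
    have \<rho>: "\<rho> \<in> perms n" using \<pi> by (simp add: rev_compl_perms)
    have "avoids \<rho> [2,1,3]"
      unfolding avoids_213
    proof (intro allI impI notI)
      fix a b c assume abc: "subseq [a,b,c] \<rho>" "b < a \<and> a < c"
      have "subseq [Suc n - c, Suc n - b, Suc n - a] \<pi>"
        using subseq_rev_compl[OF abc(1), of n] \<pi>
        by (simp add: rev_compl_rev_compl) (simp add: rev_compl_def)
      moreover have "c \<le> n" using le[OF abc(1) \<rho>] by simp
      ultimately show False using \<pi>(2) abc(2) unfolding avoids_132
        by (metis Suc_leI diff_less_mono2 le_imp_less_Suc less_trans not_le)
    qed
    with \<rho> show "\<rho> \<in> Av [2,1,3] n" by (simp add: Av_def)
  qed
qed (auto simp: Av_def rev_compl_rev_compl)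

section \<open>Specialisation at q = 1 and comparison of coefficients\<close>

lemma eval_A_gf_132: "eval_q (A_gf [1,3,2]) 1 = catalan_gf"
  by (simp add: fps_eq_iff eval_A_gf_nth card_Av_132 catalan_gf_def)

lemma eval_A_gf_213: "eval_q (A_gf [2,1,3]) 1 = catalan_gf"
  by (simp add: fps_eq_iff eval_A_gf_nth bij_betw_same_card[OF rev_compl_bij_betw]
      card_Av_132 catalan_gf_def)

text \<open>There is one increasing permutation of each length, so the series is geometric.\<close>

lemma eval_A_gf_21: "(1 - fps_X) * eval_q (A_gf [2,1]) 1 = 1"
proof -
  have "eval_q (A_gf [2,1]) 1 = Abs_fps (\<lambda>_. 1)"
    by (simp add: fps_eq_iff eval_A_gf_nth Av_21)
  then show ?thesis
    by (simp add: fps_eq_iff left_diff_distrib)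
qed

lemma eval_I_gf_132: "eval_q (I_gf [1,3,2]) 1 = (1 - fps_X) * (catalan_gf - 1)"
proof -
  let ?I = "eval_q (I_gf [1,3,2]) 1" and ?S = "eval_q (A_gf [2,1]) 1"
  have "catalan_gf = 1 + ?I + ?I * (?S - 1)"
    using arg_cong[OF A_gf_132, of "\<lambda>F. eval_q F 1"] by (simp add: eval_q_simps eval_A_gf_132)
  \<comment> \<open>The indecomposable term is absorbed as the summand with empty second part;
    multiplying by 1 - x then removes \<open>?S\<close>.\<close>
  then have "catalan_gf - 1 = ?I * ?S"
    by (simp add: algebra_simps)
  then have "(1 - fps_X) * (catalan_gf - 1) = ?I * ((1 - fps_X) * ?S)"
    by (simp only: mult_ac)
  then show ?thesis by (simp add: eval_A_gf_21)
qed

lemma eval_I_gf_1324: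
  "eval_q (I_gf [1,3,2,4]) 1 =
     eval_q (A_gf [1,3,2,4]) 1 - 1 - (1 - fps_X) * (catalan_gf - 1)\<^sup>2"
  using arg_cong[OF A_gf_1324, of "\<lambda>F. eval_q F 1"]
  by (simp add: eval_q_simps eval_A_gf_213 eval_I_gf_132 power2_eq_square mult.assoc)

text \<open>Expand x (C - 1)^2 and replace x C^2 by C - 1. The terms -1 and x do not reach the
  exponent \<open>Suc (Suc n)\<close>, which is at least 2.\<close>

lemma catalan_gf_minus_1_square_nth:
  "fps_nth ((catalan_gf - 1)\<^sup>2) (Suc n) = catalan (Suc (Suc n)) - 2 * catalan (Suc n)"
proof -
  have "fps_X * (catalan_gf - 1)\<^sup>2 = catalan_gf - 1 - 2 * (fps_X * catalan_gf) + fps_X"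
    using catalan_gf_eq by (simp add: power2_eq_square algebra_simps)
  from arg_cong[OF this, of "\<lambda>F. fps_nth F (Suc (Suc n))"] show ?thesis
    by (simp add: catalan_gf_def numeral_fps_const)
qed

lemma I_total_1324:
  assumes "n \<ge> 2"
  shows "real (I_total [1,3,2,4] n) =
    real (A_total [1,3,2,4] n) - catalan (n + 1) + 3 * catalan n - 2 * catalan (n - 1)"
proof -
  from assms obtain m where n: "n = Suc (Suc m)"
    by (metis Suc_le_D Suc_le_mono numeral_2_eq_2)
  have "real (I_total [1,3,2,4] n) = fps_nth (eval_q (I_gf [1,3,2,4]) 1) n"
    by (simp add: I_total_eq eval_I_gf_nth)
  \<comment> \<open>The factor 1 - x yields a difference of neighbouring coefficients; for
    \<open>n \<ge> 2\<close> both have positive index, as the coefficient formula requires.\<close>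
  also have "\<dots> = real (A_total [1,3,2,4] n) -
      (fps_nth ((catalan_gf - 1)\<^sup>2) n - fps_nth ((catalan_gf - 1)\<^sup>2) (n - 1))"
    by (simp add: eval_I_gf_1324 A_total_eq eval_A_gf_nth n left_diff_distrib)
  finally show ?thesis
    unfolding n by (simp add: catalan_gf_minus_1_square_nth One_nat_def)
qed

text \<open>The series (C - 1)^2 starts at x^2, so nothing is subtracted here. The formula for
  \<open>n \<ge> 2\<close> would give 0 instead.\<close>

lemma I_total_1324_1: "I_total [1,3,2,4] 1 = 1"
proof -
  have sq: "fps_nth ((catalan_gf - 1)\<^sup>2) 0 = 0" "fps_nth ((catalan_gf - 1)\<^sup>2) 1 = 0"
    by (simp_all add: power2_eq_square fps_mult_nth catalan_gf_def One_nat_def)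
  have "real (I_total [1,3,2,4] 1) = real (A_total [1,3,2,4] 1)"
    using arg_cong[OF eval_I_gf_1324, of "\<lambda>F. fps_nth F 1"] sq
    by (simp add: I_total_eq A_total_eq eval_I_gf_nth eval_A_gf_nth left_diff_distrib)
  moreover have "Av [1,3,2,4] 1 = {[1]}"
    by (auto simp: Av_def avoids_1324 permutations_of_set_singleton split: if_splits)
  ultimately show ?thesis by (simp add: A_total_eq)
qed

theorem theorem3p17:
  shows "A_gf [1,3,2,4] = 1 + I_gf [1,3,2,4] + I_gf [1,3,2] * (A_gf [2,1,3] - 1) \<and>
    eval_q (I_gf [1,3,2,4]) 1 =
      eval_q (A_gf [1,3,2,4]) 1 - 1 - (1 - fps_X) * (catalan_gf - 1)\<^sup>2 \<and>
    I_total [1,3,2,4] 1 = 1 \<and>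
    (\<forall>n\<ge>2. real (I_total [1,3,2,4] n) =
       real (A_total [1,3,2,4] n) - catalan (n + 1) + 3 * catalan n - 2 * catalan (n - 1)) \<and>
    catalan_gf = (1 - fps_radical root 2 (1 - 4 * fps_X)) / (2 * fps_X)"
  using A_gf_1324 eval_I_gf_1324 I_total_1324_1 I_total_1324 catalan_gf_closed_form by blast

end
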